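(* Let $\mathcal{A} = (a_{ijk}) \in \mathbb{R}^{m \times n \times p}$ and $\mathcal{S}=\mathcal{S}(\mathcal{A})$. Then $$\sigma_1(\mathcal{A}) = \mathcal{S}(1,1,1) \ge \max\{|a_{ijk}| : 1 \le i \le m,\ 1 \le j \le n,\ 1 \le k \le p\}.$$
   Context: For a third order tensor $\mathcal{A} = (a_{ijk}) \in \mathbb{R}^{m\times n\times p}$, let $A^{(k)} = (a_{ijk})_{i,j} \in \mathbb{R}^{m\times n}$, $k=1,\dots,p$, be its frontal slices. Kilmer-Martin mapping: put $\omega=e^{-2\pi\sqrt{-1}/p}$ and $\Delta^{(k)}=\sum_{l=1}^p \omega^{(k-1)(l-1)}A^{(l)}\in\mathbb{C}^{m\times n}$ for $k=1,\dots,p$. Let $\Sigma(1,1,k)\ge\Sigma(2,2,k)\ge\cdots\ge\Sigma(\min\{m,n\},\min\{m,n\},k)\ge 0$ be the singular values of the matrix $\Delta^{(k)}$ in non-increasing order. Then $\mathcal{S}=\mathcal{S}(\mathcal{A})\in\mathbb{R}^{m\times n\times p}$ is the (real) tensor all of whose frontal slices are diagonal, with diagonal entries $\mathcal{S}(i,i,k)=\frac1p\sum_{l=1}^p\bar\omega^{(k-1)(l-1)}\Sigma(i,i,l)$ for $1\le i\le\min\{m,n\}$, $1\le k\le p$. The singular values of $\mathcal{A}$ are the absolute values $|\mathcal{S}(i,i,k)|$, $1\le i\le\min\{m,n\}$, $1\le k\le p$; $\sigma_1(\mathcal{A})$ denotes the largest of them. *)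

theory Defs
  imports
    Complex_Main
    "HOL-Computational_Algebra.Computational_Algebra"
    "Jordan_Normal_Form.Schur_Decomposition"
begin

(* The entry a_{ijk} of an m x n x p tensor is A i j k with indices starting at 1; values
   outside 1..m, 1..n, 1..p are ignored.  Library matrices are indexed from 0. *)
type_synonym tensor = "nat \<Rightarrow> nat \<Rightarrow> nat \<Rightarrow> real"

definition frontal_slice :: "nat \<Rightarrow> nat \<Rightarrow> tensor \<Rightarrow> nat \<Rightarrow> real mat" where
  "frontal_slice m n A k = mat m n (\<lambda>(i, j). A (i + 1) (j + 1) k)"

definition dft_root :: "nat \<Rightarrow> complex" where
  "dft_root p = exp (- (2 * complex_of_real pi * \<i> / of_nat p))"

definition dft_slice :: "nat \<Rightarrow> nat \<Rightarrow> nat \<Rightarrow> tensor \<Rightarrow> nat \<Rightarrow> complex mat" where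
  "dft_slice m n p A k = mat m n (\<lambda>ij.
     \<Sum>l = 1..p. dft_root p ^ ((k - 1) * (l - 1)) * complex_of_real (frontal_slice m n A l $$ ij))"

(* The square roots of the min(m,n) largest eigenvalues of M^* M, with algebraic multiplicity, in
   non-increasing order.  These eigenvalues are real and nonnegative (see gram_eigenvalue), so
   that taking Re discards nothing. *)
definition mat_singular_values :: "complex mat \<Rightarrow> real list" where
  "mat_singular_values M =
     take (min (dim_row M) (dim_col M))
       (rev (sorted_list_of_multiset
         (image_mset (\<lambda>z. sqrt (Re z)) (proots (char_poly (mat_adjoint M * M))))))"

definition KM_Sigma :: "nat \<Rightarrow> nat \<Rightarrow> nat \<Rightarrow> tensor \<Rightarrow> nat \<Rightarrow> nat \<Rightarrow> real" where
  "KM_Sigma m n p A i k = mat_singular_values (dft_slice m n p A k) ! (i - 1)"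

(* The Fourier sum is real (see KM_S_diag), so Re only converts the type. *)
definition KM_S :: "nat \<Rightarrow> nat \<Rightarrow> nat \<Rightarrow> tensor \<Rightarrow> tensor" where
  "KM_S m n p A i j k =
     (if i = j
      then Re (1 / of_nat p * (\<Sum>l = 1..p.
             cnj (dft_root p) ^ ((k - 1) * (l - 1)) * complex_of_real (KM_Sigma m n p A i l)))
      else 0)"

definition tensor_singular_values :: "nat \<Rightarrow> nat \<Rightarrow> nat \<Rightarrow> tensor \<Rightarrow> real set" where
  "tensor_singular_values m n p A = {\<bar>KM_S m n p A i i k\<bar> | i k. i \<in> {1..min m n} \<and> k \<in> {1..p}}"

definition tensor_sigma1 :: "nat \<Rightarrow> nat \<Rightarrow> nat \<Rightarrow> tensor \<Rightarrow> real" where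
  "tensor_sigma1 m n p A = Max (tensor_singular_values m n p A)"


lemma mat_adjoint_dims [simp]:
  "dim_row (mat_adjoint M) = dim_col M" "dim_col (mat_adjoint M) = dim_row M"
  by (simp_all add: mat_adjoint_def)

lemma mat_adjoint_index:
  "i < dim_col M \<Longrightarrow> j < dim_row M \<Longrightarrow> mat_adjoint M $$ (i, j) = conjugate (M $$ (j, i))"
  by (simp add: mat_adjoint_def mat_of_rows_def)

lemma gram_carrier: "(mat_adjoint M * M) \<in> carrier_mat (dim_col M) (dim_col M)"
  by (intro carrier_matI) simp_all

lemma gram_char_poly_nz: "char_poly (mat_adjoint M * M) \<noteq> 0"
  using degree_monic_char_poly[OF gram_carrier[of M]] by auto

lemma scalar_adjoint:
  fixes M :: "complex mat"
  assumes v: "v \<in> carrier_vec (dim_col M)" and w: "w \<in> carrier_vec (dim_row M)"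
  shows "(mat_adjoint M *\<^sub>v w) \<bullet>c v = w \<bullet>c (M *\<^sub>v v)"
proof -
  have "(mat_adjoint M *\<^sub>v w) \<bullet>c v =
      (\<Sum>i<dim_col M. \<Sum>j<dim_row M. cnj (M $$ (j, i)) * w $ j * cnj (v $ i))"
    using v w by (auto simp: scalar_prod_def mat_adjoint_index sum_distrib_right lessThan_atLeast0
        intro!: sum.cong)
  also have "\<dots> = (\<Sum>j<dim_row M. \<Sum>i<dim_col M. cnj (M $$ (j, i)) * w $ j * cnj (v $ i))"
    by (rule sum.swap)
  also have "\<dots> = w \<bullet>c (M *\<^sub>v v)"
    using v w by (auto simp: scalar_prod_def sum_distrib_left lessThan_atLeast0 mult_ac
        intro!: sum.cong)
  finally show ?thesis .
qed

lemma self_scalar_real: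
  fixes v :: "complex vec"
  shows "v \<bullet>c v = complex_of_real (\<Sum>i<dim_vec v. (cmod (v $ i))\<^sup>2)"
  unfolding of_real_sum
  by (auto simp: scalar_prod_def lessThan_atLeast0 complex_norm_square
      simp del: of_real_power intro!: sum.cong)

lemma gram_eigenvalue:
  assumes "z \<in># proots (char_poly (mat_adjoint M * M))"
  shows "z = complex_of_real (Re z)" "Re z \<ge> 0"
proof -
  have "eigenvalue (mat_adjoint M * M) z"
    using assms gram_char_poly_nz[of M] eigenvalue_root_char_poly[OF gram_carrier[of M]] by auto
  then obtain v where v: "v \<in> carrier_vec (dim_col M)" "v \<noteq> 0\<^sub>v (dim_col M)"
      and ev: "(mat_adjoint M * M) *\<^sub>v v = z \<cdot>\<^sub>v v"
    unfolding eigenvalue_def eigenvector_def by auto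
  let ?r = "\<lambda>v. \<Sum>i<dim_vec v. (cmod (v $ i))\<^sup>2"
  have Mv: "M *\<^sub>v v \<in> carrier_vec (dim_row M)" by (intro carrier_vecI) simp
  have "(mat_adjoint M * M) *\<^sub>v v = mat_adjoint M *\<^sub>v (M *\<^sub>v v)"
    using v by (intro assoc_mult_mat_vec[where ?n\<^sub>1 = "dim_col M" and ?n\<^sub>2 = "dim_row M"
      and ?n\<^sub>3 = "dim_col M"]) (auto intro!: carrier_matI)
  then have "z * (v \<bullet>c v) = (M *\<^sub>v v) \<bullet>c (M *\<^sub>v v)"
    using scalar_adjoint[OF v(1) Mv] v(1) ev by (simp flip: smult_scalar_prod_distrib)
  then have eq: "z * complex_of_real (?r v) = complex_of_real (?r (M *\<^sub>v v))"
    by (simp only: self_scalar_real)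
  have "v \<bullet>c v \<noteq> 0" using v conjugate_square_eq_0_vec[OF v(1)] by auto
  then have "?r v \<noteq> 0" unfolding self_scalar_real by (metis of_real_0)
  moreover have "?r v \<ge> 0" by (intro sum_nonneg) auto
  ultimately have pos: "?r v > 0" by linarith
  then have "z = complex_of_real (?r (M *\<^sub>v v)) / complex_of_real (?r v)"
    using eq \<open>?r v \<noteq> 0\<close> by (metis nonzero_eq_divide_eq of_real_eq_0_iff)
  then have z: "z = complex_of_real (?r (M *\<^sub>v v) / ?r v)" by (simp only: of_real_divide)
  then show "z = complex_of_real (Re z)" by (metis Re_complex_of_real)
  have "?r (M *\<^sub>v v) / ?r v \<ge> 0" using pos by (intro divide_nonneg_pos sum_nonneg) auto
  then show "Re z \<ge> 0" using z by (metis Re_complex_of_real)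
qed

lemma length_mat_singular_values:
  "length (mat_singular_values M) = min (dim_row M) (dim_col M)"
proof -
  have "length (sorted_list_of_multiset X) = size X" for X :: "real multiset"
    by (metis mset_sorted_list_of_multiset size_mset)
  then show ?thesis
    using degree_monic_char_poly[OF gram_carrier[of M]]
    by (simp add: mat_singular_values_def size_proots_complex)
qed

lemma sorted_mat_singular_values: "sorted_wrt (\<ge>) (mat_singular_values M)"
proof -
  have "sorted_wrt (\<ge>) (rev (sorted_list_of_multiset X))" for X :: "real multiset"
    using sorted_sorted_list_of_multiset[of X] by (simp add: sorted_wrt_rev)
  then show ?thesis
    by (simp add: mat_singular_values_def sorted_wrt_take)
qed

lemma proots_map_cnj: "proots (map_poly cnj q) = image_mset cnj (proots q)"
proof (cases "q = 0")
  case False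
  interpret c: map_poly_comm_ring_hom cnj by standard auto
  obtain rs where rs: "mset rs = proots q" using ex_mset by blast
  have q: "q = Polynomial.smult (lead_coeff q) (\<Prod>x\<leftarrow>rs. [:-x, 1:])"
    using complex_poly_decompose_multiset[of q, symmetric]
    by (simp flip: rs prod_mset_prod_list)
  have "map_poly cnj q = Polynomial.smult (cnj (lead_coeff q)) (\<Prod>x\<leftarrow>rs. [:- cnj x, 1:])"
    by (subst q) (simp add: c.base.map_poly_hom_smult c.hom_prod_list o_def)
  moreover have "proots (\<Prod>x\<leftarrow>rs. [:- cnj x, 1:]) = image_mset cnj (mset rs)"
  proof (induction rs)
    case (Cons r rs)
    have nz: "[:- cnj r, 1:] \<noteq> 0" "(\<Prod>x\<leftarrow>rs. [:- cnj x, 1:]) \<noteq> 0"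
      by (auto simp: prod_list_zero_iff)
    show ?case using Cons.IH proots_mult[OF nz] by (simp del: mult_pCons_left)
  qed simp
  ultimately show ?thesis using False rs by simp
qed simp

lemma mat_singular_values_cnj:
  "mat_singular_values (map_mat cnj M) = mat_singular_values M"
proof -
  interpret c: comm_ring_hom cnj by standard auto
  have "mat_adjoint (map_mat cnj M) * map_mat cnj M = map_mat cnj (mat_adjoint M * M)"
    by (rule eq_matI) (auto simp: scalar_prod_def mat_adjoint_index intro!: sum.cong)
  then have "char_poly (mat_adjoint (map_mat cnj M) * map_mat cnj M)
      = map_poly cnj (char_poly (mat_adjoint M * M))"
    using c.char_poly_hom[OF gram_carrier[of M]] by simp
  then show ?thesis
    by (simp add: mat_singular_values_def proots_map_cnj image_mset.compositionality o_def)
qed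

lemma dft_root_power_self: "p > 0 \<Longrightarrow> dft_root p ^ p = 1"
  by (simp add: dft_root_def exp_minus exp_of_nat_mult[symmetric] power_inverse mult_ac)

lemma dft_root_cnj: "dft_root p * cnj (dft_root p) = 1"
proof -
  have "cmod (dft_root p) = 1" by (simp add: dft_root_def norm_exp_eq_Re)
  then show ?thesis using complex_norm_square[of "dft_root p"] by simp
qed

lemma cnj_dft_root_power:
  assumes "p > 0" "a + b = p \<or> a + b = 0"
  shows "cnj (dft_root p) ^ (a * c) = dft_root p ^ (b * c)"
proof -
  let ?w = "dft_root p"
  have "?w ^ (a + b) = 1" using assms dft_root_power_self by auto
  then have "?w ^ a * ?w ^ b = 1" by (simp add: power_add)
  moreover have "?w ^ a * cnj ?w ^ a = 1"
    by (simp add: dft_root_cnj flip: power_mult_distrib)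
  ultimately have "cnj ?w ^ a = ?w ^ b"
    by (metis mult.commute mult.left_commute mult.right_neutral)
  then show ?thesis by (simp add: power_mult)
qed

definition dft_flip :: "nat \<Rightarrow> nat \<Rightarrow> nat" where
  "dft_flip p k = (if k = 1 then 1 else p + 2 - k)"

lemma KM_Sigma_flip:
  assumes "k \<in> {1..p}"
  shows "KM_Sigma m n p A i (dft_flip p k) = KM_Sigma m n p A i k"
proof -
  have ab: "(k - 1) + (dft_flip p k - 1) = p \<or> (k - 1) + (dft_flip p k - 1) = 0"
    using assms by (auto simp: dft_flip_def)
  have "dft_slice m n p A (dft_flip p k) = map_mat cnj (dft_slice m n p A k)"
    using assms cnj_dft_root_power[OF _ ab] by (intro eq_matI) (auto simp: dft_slice_def)
  then show ?thesis by (simp add: KM_Sigma_def mat_singular_values_cnj)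
qed

lemma KM_S_diag:
  "complex_of_real (KM_S m n p A i i k) = 1 / of_nat p *
     (\<Sum>l = 1..p. cnj (dft_root p) ^ ((k - 1) * (l - 1)) * complex_of_real (KM_Sigma m n p A i l))"
proof -
  let ?f = "\<lambda>l. cnj (dft_root p) ^ ((k - 1) * (l - 1)) * complex_of_real (KM_Sigma m n p A i l)"
  have "cnj (\<Sum>l = 1..p. ?f l) = (\<Sum>l = 1..p. cnj (?f l))" by simp
  also have "\<dots> = (\<Sum>l = 1..p. ?f l)"
  proof (rule sum.reindex_bij_witness[of _ "dft_flip p" "dft_flip p"])
    fix l assume l: "l \<in> {1..p}"
    then have ab: "(dft_flip p l - 1) + (l - 1) = p \<or> (dft_flip p l - 1) + (l - 1) = 0"
      by (auto simp: dft_flip_def)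
    show "?f (dft_flip p l) = cnj (?f l)"
      using l KM_Sigma_flip[OF l, of m n A i] cnj_dft_root_power[OF _ ab, of "k - 1"]
      by (simp add: mult.commute)
  qed (auto simp: dft_flip_def)
  finally have "(\<Sum>l = 1..p. ?f l) \<in> \<real>" by (simp only: Reals_cnj_iff)
  then have "1 / of_nat p * (\<Sum>l = 1..p. ?f l) \<in> \<real>" by (intro Reals_mult) auto
  then show ?thesis by (simp only: KM_S_def if_True refl of_real_Re)
qed

end

theory Submission
  imports Defs "Jordan_Normal_Form.Spectral_Radius"
begin

text \<open>Write \<open>\<Delta>\<^sub>l\<close> for the Fourier slices and \<open>\<Sigma>(i,i,l)\<close> for their singular values.  The entry
  \<open>S(1,1,1)\<close> is the mean over \<open>l\<close> of the largest singular values \<open>\<Sigma>(1,1,l)\<close>, and the triangle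
  inequality bounds both quantities of the theorem by this mean.  Each \<open>S(i,i,k)\<close> is a mean of the
  numbers \<open>\<Sigma>(i,i,l) \<le> \<Sigma>(1,1,l)\<close> with weights of modulus \<open>1\<close> (\<open>abs_KM_S_le\<close>).  By Fourier
  inversion (\<open>dft_slice_inversion\<close>), each entry of the tensor is likewise such a mean of the
  entries of the \<open>\<Delta>\<^sub>l\<close> at one position, and no entry of a matrix exceeds its largest singular
  value in modulus (\<open>cmod_entry_le_largest_singular_value\<close>).

  The last fact is the only one that touches spectral theory.  The squared modulus of an entry of
  \<open>M\<close> in column \<open>j\<close> is at most the \<open>j\<close>-th diagonal entry of the Gram matrix \<open>M\<^sup>* M\<close>, so it
  suffices that the diagonal entries of a Hermitian matrix are bounded by its spectral radius
  (\<open>self_adjoint_diag_le_spectral_radius\<close>).  This is derived without a unitary diagonalization,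
  from the growth of the powers of the matrix: they stay bounded when the spectral radius is below
  \<open>1\<close>, whereas repeated squaring blows up a diagonal entry of modulus above \<open>1\<close>.\<close>

section \<open>Diagonal entries of Hermitian matrices\<close>

lemma mat_adjoint_eq_index:
  fixes H :: "complex mat"
  assumes "H \<in> carrier_mat n n" "mat_adjoint H = H" "i < n" "j < n"
  shows "cnj (H $$ (j, i)) = H $$ (i, j)"
  using assms mat_adjoint_index[of i H j] by simp

lemma gram_self_adjoint:
  fixes M :: "complex mat"
  shows "mat_adjoint (mat_adjoint M * M) = mat_adjoint M * M"
  by (rule eq_matI) (auto simp: mat_adjoint_index scalar_prod_def mult.commute intro!: sum.cong)

lemma gram_diag:
  fixes M :: "complex mat"
  assumes "j < dim_col M"
  shows "(mat_adjoint M * M) $$ (j, j) = complex_of_real (\<Sum>i<dim_row M. (cmod (M $$ (i, j)))\<^sup>2)"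
  using assms unfolding of_real_sum
  by (auto simp: scalar_prod_def mat_adjoint_index lessThan_atLeast0 complex_norm_square mult.commute
      simp del: of_real_power intro!: sum.cong)

lemma cmod_entry_le_gram_diag:
  fixes M :: "complex mat"
  assumes "i < dim_row M" "j < dim_col M"
  shows "(cmod (M $$ (i, j)))\<^sup>2 \<le> cmod ((mat_adjoint M * M) $$ (j, j))"
proof -
  have "(cmod (M $$ (i, j)))\<^sup>2 \<le> (\<Sum>i<dim_row M. (cmod (M $$ (i, j)))\<^sup>2)"
    using assms by (intro member_le_sum) auto
  also have "\<dots> \<le> cmod ((mat_adjoint M * M) $$ (j, j))"
    unfolding gram_diag[OF assms(2)] norm_of_real by simp
  finally show ?thesis .
qed

lemma pow_mat_double:
  fixes A :: "complex mat"
  assumes A: "A \<in> carrier_mat n n"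
  shows "A ^\<^sub>m (2 * k) = A ^\<^sub>m k * A ^\<^sub>m k"
proof -
  interpret ring "ring_mat TYPE(complex) n ()" by (rule ring_mat)
  have "A \<in> carrier (ring_mat TYPE(complex) n ())" using A by (simp add: ring_mat_simps)
  from nat_pow_mult[OF this, of k k] show ?thesis
    by (simp add: pow_mat_ring_pow[OF A, of _ "()"] ring_mat_simps flip: mult_2)
qed

text \<open>Squaring a Hermitian matrix at least squares each diagonal entry, because the diagonal of
  \<open>H\<^sup>2\<close> consists of the squared lengths of the rows of \<open>H\<close>.  Exponents of the form \<open>2 ^ r\<close> let this
  be iterated.\<close>

lemma self_adjoint_diag_power_le:
  fixes A :: "complex mat"
  assumes A: "A \<in> carrier_mat n n" and adj: "mat_adjoint A = A" and j: "j < n"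
  shows "cmod (A $$ (j, j)) ^ (2 ^ r) \<le> cmod ((A ^\<^sub>m (2 ^ r)) $$ (j, j))"
proof -
  have "mat_adjoint (A ^\<^sub>m (2 ^ r)) = A ^\<^sub>m (2 ^ r) \<and>
      cmod (A $$ (j, j)) ^ (2 ^ r) \<le> cmod ((A ^\<^sub>m (2 ^ r)) $$ (j, j))"
  proof (induction r)
    case 0
    then show ?case using A adj by simp
  next
    case (Suc r)
    define H where "H = A ^\<^sub>m (2 ^ r)"
    have H: "H \<in> carrier_mat n n" using A by (simp add: H_def)
    have adjH: "mat_adjoint H = H"
      and le: "cmod (A $$ (j, j)) ^ (2 ^ r) \<le> cmod (H $$ (j, j))"
      using Suc.IH by (auto simp: H_def)
    have sq: "A ^\<^sub>m (2 ^ Suc r) = H * H"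
      using pow_mat_double[OF A, of "2 ^ r"] by (simp add: H_def)
    have "cmod (A $$ (j, j)) ^ (2 ^ Suc r) = (cmod (A $$ (j, j)) ^ (2 ^ r))\<^sup>2"
      by (simp add: power_mult mult.commute[of 2])
    also have "\<dots> \<le> (cmod (H $$ (j, j)))\<^sup>2" using le by (intro power_mono) auto
    \<comment> \<open>As \<open>H\<close> is self-adjoint, \<open>H * H\<close> is its own Gram matrix.\<close>
    also have "\<dots> \<le> cmod ((H * H) $$ (j, j))"
      using cmod_entry_le_gram_diag[of j H j] H j by (simp add: adjH)
    finally show ?case using sq gram_self_adjoint[of H] by (simp add: adjH)
  qed
  then show ?thesis by blast
qed

lemma spectral_radius_smult_less:
  fixes A :: "complex mat"
  assumes A: "A \<in> carrier_mat n n" and n: "n > 0" and less: "spectral_radius A < \<mu>" and \<mu>: "\<mu> > 0"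
  shows "spectral_radius (complex_of_real (1 / \<mu>) \<cdot>\<^sub>m A) < 1"
proof -
  let ?B = "complex_of_real (1 / \<mu>) \<cdot>\<^sub>m A"
  have B: "?B \<in> carrier_mat n n" using A by simp
  from spectral_radius_mem_max(1)[OF B n] obtain z
    where z: "spectral_radius ?B = cmod z" "eigenvalue ?B z" by (auto simp: spectrum_def)
  then obtain v where v: "v \<in> carrier_vec n" "v \<noteq> 0\<^sub>v n" "?B *\<^sub>v v = z \<cdot>\<^sub>v v"
    using B unfolding eigenvalue_def eigenvector_def by auto
  have "A *\<^sub>v v = complex_of_real \<mu> \<cdot>\<^sub>v (?B *\<^sub>v v)"
    using A v(1) \<mu> by (intro eq_vecI) (auto simp: scalar_prod_def sum_distrib_left)
  also have "\<dots> = (complex_of_real \<mu> * z) \<cdot>\<^sub>v v" unfolding v(3) by (rule smult_smult_assoc)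
  finally have "eigenvalue A (complex_of_real \<mu> * z)"
    using A v unfolding eigenvalue_def eigenvector_def by auto
  then have "cmod (complex_of_real \<mu> * z) \<in> norm ` spectrum A" by (auto simp: spectrum_def)
  from spectral_radius_mem_max(2)[OF A n this] have "\<mu> * cmod z \<le> spectral_radius A"
    using \<mu> by (simp add: norm_mult)
  then have "\<mu> * cmod z < \<mu> * 1" using less by linarith
  then have "cmod z < 1" using \<mu> by (simp only: mult_less_cancel_left_pos)
  then show ?thesis using z \<mu> by simp
qed

text \<open>If a diagonal entry exceeded the spectral radius, a rescaling would have spectral radius
  below \<open>1\<close> and that diagonal entry above \<open>1\<close>.  The former makes all powers of the rescaled matrix
  uniformly bounded, while the latter makes the entry in the powers \<open>2 ^ r\<close> unbounded.\<close>

lemma self_adjoint_diag_le_spectral_radius: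
  fixes A :: "complex mat"
  assumes A: "A \<in> carrier_mat n n" and adj: "mat_adjoint A = A" and j: "j < n"
  shows "cmod (A $$ (j, j)) \<le> spectral_radius A"
proof (rule ccontr)
  assume "\<not> ?thesis"
  then have "spectral_radius A < cmod (A $$ (j, j))" by simp
  from dense[OF this] obtain \<mu> where \<mu>: "spectral_radius A < \<mu>" "\<mu> < cmod (A $$ (j, j))"
    by (elim exE conjE)
  have n: "n > 0" using j by simp
  have "spectral_radius A \<ge> 0" using spectral_radius_mem_max(1)[OF A n] by auto
  then have pos: "\<mu> > 0" using \<mu> by simp
  define B where "B = complex_of_real (1 / \<mu>) \<cdot>\<^sub>m A"
  have B: "B \<in> carrier_mat n n" using A by (simp add: B_def)
  have adjB: "mat_adjoint B = B"
    using A by (intro eq_matI) (auto simp: B_def mat_adjoint_index mat_adjoint_eq_index[OF A adj])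
  have "spectral_radius B < 1"
    unfolding B_def by (rule spectral_radius_smult_less[OF A n \<mu>(1) pos])
  then obtain c where c: "\<And>k. norm_bound (B ^\<^sub>m k) c"
    using spectral_radius_jnf_norm_bound_less_1_upper_triangular[OF B] by blast
  have gt: "cmod (B $$ (j, j)) > 1"
    using A j \<mu> pos by (simp add: B_def norm_divide)
  then obtain r where r: "c < cmod (B $$ (j, j)) ^ r" using real_arch_pow by blast
  also have "\<dots> \<le> cmod (B $$ (j, j)) ^ (2 ^ r)"
    using gt by (intro power_increasing) (auto intro: less_imp_le)
  also have "\<dots> \<le> cmod ((B ^\<^sub>m (2 ^ r)) $$ (j, j))"
    by (rule self_adjoint_diag_power_le[OF B adjB j])
  also have "\<dots> \<le> c" using c[of "2 ^ r"] B j by (auto simp: norm_bound_def)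
  finally show False by simp
qed

section \<open>The largest singular value of a matrix\<close>

lemma mat_singular_values_nonneg:
  assumes "x \<in> set (mat_singular_values M)"
  shows "x \<ge> 0"
proof -
  have "x \<in># image_mset (\<lambda>z. sqrt (Re z)) (proots (char_poly (mat_adjoint M * M)))"
    using in_set_takeD[OF assms[unfolded mat_singular_values_def]] by simp
  then show ?thesis using gram_eigenvalue(2)[of _ M] by auto
qed

lemma mat_singular_values_le_first:
  assumes "i < min (dim_row M) (dim_col M)"
  shows "mat_singular_values M ! i \<le> mat_singular_values M ! 0"
proof (cases "i = 0")
  case False
  then show ?thesis
    using assms sorted_wrt_nth_less[OF sorted_mat_singular_values[of M], of 0 i]
    by (simp add: length_mat_singular_values)
qed simp

text \<open>The list of singular values omits all but the first \<open>min m n\<close> square roots of the Gram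
  eigenvalues.  Since that list starts with the largest of them, its first element still bounds
  every Gram eigenvalue, which is all that the comparison with the spectral radius needs.\<close>

lemma sqrt_gram_eigenvalue_le:
  assumes nz: "dim_row M > 0" "dim_col M > 0"
    and z: "z \<in># proots (char_poly (mat_adjoint M * M))"
  shows "sqrt (Re z) \<le> mat_singular_values M ! 0"
proof -
  define L where "L = rev (sorted_list_of_multiset
    (image_mset (\<lambda>z. sqrt (Re z)) (proots (char_poly (mat_adjoint M * M)))))"
  have "sqrt (Re z) \<in> set L" using z by (auto simp: L_def)
  then obtain i where i: "i < length L" "L ! i = sqrt (Re z)" by (auto simp: in_set_conv_nth)
  have "sorted_wrt (\<ge>) L"
    by (simp add: L_def sorted_wrt_rev)
  then have "L ! i \<le> L ! 0"
    using i(1) sorted_wrt_nth_less[of "(\<ge>)" L 0 i] by (cases "i = 0") auto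
  moreover have "mat_singular_values M ! 0 = L ! 0"
    using nz by (simp add: mat_singular_values_def L_def)
  ultimately show ?thesis using i by simp
qed

lemma spectral_radius_gram_le:
  assumes nz: "dim_row M > 0" "dim_col M > 0"
  shows "spectral_radius (mat_adjoint M * M) \<le> (mat_singular_values M ! 0)\<^sup>2"
proof -
  let ?G = "mat_adjoint M * M"
  from spectral_radius_mem_max(1)[OF gram_carrier nz(2)] obtain z
    where z: "spectral_radius ?G = cmod z" "eigenvalue ?G z" by (auto simp: spectrum_def)
  then have mem: "z \<in># proots (char_poly ?G)"
    using eigenvalue_root_char_poly[OF gram_carrier[of M]] gram_char_poly_nz[of M] by simp
  have "cmod z = Re z" using gram_eigenvalue[OF mem] by (metis abs_of_nonneg norm_of_real)
  also have "\<dots> = (sqrt (Re z))\<^sup>2" using gram_eigenvalue(2)[OF mem] by simp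
  also have "\<dots> \<le> (mat_singular_values M ! 0)\<^sup>2"
    using sqrt_gram_eigenvalue_le[OF nz mem] gram_eigenvalue(2)[OF mem]
    by (intro power_mono) auto
  finally show ?thesis using z by simp
qed

text \<open>The Gram matrix trades an arbitrary entry for a diagonal one, at the price of a square, and
  its spectral radius is controlled by the square of the largest singular value.\<close>

lemma cmod_entry_le_largest_singular_value:
  assumes "i < dim_row M" "j < dim_col M"
  shows "cmod (M $$ (i, j)) \<le> mat_singular_values M ! 0"
proof -
  have nz: "dim_row M > 0" "dim_col M > 0" using assms by auto
  have "(cmod (M $$ (i, j)))\<^sup>2 \<le> cmod ((mat_adjoint M * M) $$ (j, j))"
    by (rule cmod_entry_le_gram_diag[OF assms])
  also have "\<dots> \<le> spectral_radius (mat_adjoint M * M)"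
    by (rule self_adjoint_diag_le_spectral_radius[OF gram_carrier gram_self_adjoint assms(2)])
  also have "\<dots> \<le> (mat_singular_values M ! 0)\<^sup>2" by (rule spectral_radius_gram_le[OF nz])
  finally show ?thesis
  proof (rule power2_le_imp_le)
    show "mat_singular_values M ! 0 \<ge> 0"
      using nz by (intro mat_singular_values_nonneg[of _ M] nth_mem) (simp add: length_mat_singular_values)
  qed
qed

section \<open>Fourier inversion along the third index\<close>

text \<open>The form \<open>cis\<close> makes it visible that the powers with exponents below \<open>p\<close> are distinct.\<close>

lemma cnj_dft_root_power_cis: "cnj (dft_root p) ^ a = cis (2 * pi * real a / real p)"
proof -
  have "dft_root p = cis (- (2 * pi / real p))"
    unfolding dft_root_def cis_conv_exp by (rule arg_cong[of _ _ exp]) simp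
  then have "cnj (dft_root p) = cis (2 * pi / real p)" by (simp only: cis_cnj minus_minus)
  then have "cnj (dft_root p) ^ a = cis (real a * (2 * pi / real p))" by (simp only: DeMoivre)
  also have "real a * (2 * pi / real p) = 2 * pi * real a / real p" by simp
  finally show ?thesis .
qed

text \<open>Each summand is \<open>x ^ l\<close> for the ratio \<open>x\<close> of two \<open>p\<close>-th roots of unity.  For \<open>a \<noteq> b\<close> the ratio
  is a \<open>p\<close>-th root of unity other than \<open>1\<close>, and the geometric sum vanishes.\<close>

lemma dft_root_orthogonality:
  assumes a: "a < p" and b: "b < p"
  shows "(\<Sum>l<p. cnj (dft_root p) ^ (a * l) * dft_root p ^ (l * b)) = (if a = b then of_nat p else 0)"
proof -
  let ?w = "dft_root p"
  define x where "x = cnj ?w ^ a * ?w ^ b"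
  have p: "p > 0" using a by simp
  have unit: "cnj ?w ^ c * ?w ^ c = 1" for c
    by (simp add: dft_root_cnj mult.commute flip: power_mult_distrib)
  have sum: "(\<Sum>l<p. cnj ?w ^ (a * l) * ?w ^ (l * b)) = (\<Sum>l<p. x ^ l)"
    by (simp add: x_def power_mult_distrib mult.commute[of _ b] flip: power_mult)
  have "?w ^ p = 1" "cnj ?w ^ p = 1"
    using dft_root_power_self[OF p] by (auto simp flip: complex_cnj_power)
  then have xp: "x ^ p = 1"
    by (simp add: x_def power_mult_distrib power_mult[of _ p] mult.commute[of _ p] flip: power_mult)
  show ?thesis
  proof (cases "a = b")
    case True
    then show ?thesis using sum unit by (simp add: x_def)
  next
    case False
    have "x \<noteq> 1"
    proof
      assume "x = 1"
      then have "cnj ?w ^ a * (?w ^ b * cnj ?w ^ b) = cnj ?w ^ b"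
        by (simp add: x_def mult.assoc[symmetric])
      then have "cnj ?w ^ a = cnj ?w ^ b"
        using unit[of b] by (metis mult.commute mult.right_neutral)
      then show False
        using False a b bij_betw_roots_unity[OF p]
        by (auto simp: cnj_dft_root_power_cis bij_betw_def inj_on_def)
    qed
    then show ?thesis using sum xp False by (simp add: geometric_sum)
  qed
qed

lemma dft_slice_dims:
  "dim_row (dft_slice m n p A l) = m" "dim_col (dft_slice m n p A l) = n"
  by (simp_all add: dft_slice_def)

lemma dft_slice_inversion:
  assumes "i < m" "j < n" and k: "k < p"
  shows "(\<Sum>l<p. cnj (dft_root p) ^ (k * l) * dft_slice m n p A (Suc l) $$ (i, j))
    = of_nat p * complex_of_real (A (Suc i) (Suc j) (Suc k))"
proof -
  let ?w = "dft_root p" and ?a = "\<lambda>h. complex_of_real (A (Suc i) (Suc j) (Suc h))"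
  have "dft_slice m n p A (Suc l) $$ (i, j) = (\<Sum>h<p. ?w ^ (l * h) * ?a h)" for l
    using assms by (simp add: dft_slice_def frontal_slice_def sum.atLeast1_atMost_eq)
  then have "(\<Sum>l<p. cnj ?w ^ (k * l) * dft_slice m n p A (Suc l) $$ (i, j))
      = (\<Sum>l<p. \<Sum>h<p. cnj ?w ^ (k * l) * ?w ^ (l * h) * ?a h)"
    by (simp add: sum_distrib_left mult.assoc)
  also have "\<dots> = (\<Sum>h<p. (\<Sum>l<p. cnj ?w ^ (k * l) * ?w ^ (l * h)) * ?a h)"
    unfolding sum_distrib_right by (rule sum.swap)
  also have "\<dots> = (\<Sum>h<p. if k = h then of_nat p * ?a h else 0)"
    using k by (intro sum.cong) (auto simp: dft_root_orthogonality)
  also have "\<dots> = of_nat p * ?a k" using k by simp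
  finally show ?thesis .
qed

section \<open>The first diagonal entry of the Kilmer-Martin image\<close>

lemma KM_S_first: "KM_S m n p A i i 1 = (\<Sum>l=1..p. KM_Sigma m n p A i l) / real p"
  by (simp add: KM_S_def)

lemma cmod_dft_root: "cmod (dft_root p) = 1"
  by (simp add: dft_root_def norm_exp_eq_Re)

text \<open>The Fourier weights have modulus \<open>1\<close>, so the triangle inequality loses only the phases; for
  \<open>i = k = 1\<close> there are none to lose.\<close>

lemma abs_KM_S_le:
  assumes i: "i \<in> {1..min m n}" and p: "p \<ge> 1"
  shows "\<bar>KM_S m n p A i i k\<bar> \<le> KM_S m n p A 1 1 1"
proof -
  have nonneg: "KM_Sigma m n p A i l \<ge> 0" for l
    unfolding KM_Sigma_def using i
    by (intro mat_singular_values_nonneg[of _ "dft_slice m n p A l"] nth_mem)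
      (auto simp: length_mat_singular_values dft_slice_dims)
  have le: "KM_Sigma m n p A i l \<le> KM_Sigma m n p A 1 l" for l
  proof -
    have "i - 1 < min (dim_row (dft_slice m n p A l)) (dim_col (dft_slice m n p A l))"
      unfolding dft_slice_dims using i by (simp, linarith)
    then show ?thesis
      using mat_singular_values_le_first by (simp add: KM_Sigma_def)
  qed
  let ?f = "\<lambda>l. cnj (dft_root p) ^ ((k - 1) * (l - 1)) * complex_of_real (KM_Sigma m n p A i l)"
  have "\<bar>KM_S m n p A i i k\<bar> = cmod (1 / of_nat p * (\<Sum>l=1..p. ?f l))"
    unfolding KM_S_diag[symmetric] by simp
  also have "\<dots> = cmod (\<Sum>l=1..p. ?f l) / real p" by (simp add: norm_divide)
  also have "\<dots> \<le> (\<Sum>l=1..p. KM_Sigma m n p A 1 l) / real p"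
  proof (intro divide_right_mono sum_norm_le)
    show "cmod (?f l) \<le> KM_Sigma m n p A 1 l" for l
      using nonneg le by (simp add: norm_mult norm_power cmod_dft_root)
  qed simp
  also have "\<dots> = KM_S m n p A 1 1 1" by (simp only: KM_S_first)
  finally show ?thesis .
qed

text \<open>Inversion turns the entry into a mean of entries of the Fourier slices, with weights of modulus
  \<open>1\<close>; each of these is at most the largest singular value of its slice.\<close>

lemma abs_entry_le_KM_S:
  assumes i: "i < m" and j: "j < n" and k: "k < p"
  shows "\<bar>A (Suc i) (Suc j) (Suc k)\<bar> \<le> KM_S m n p A 1 1 1"
proof -
  let ?D = "\<lambda>l. dft_slice m n p A (Suc l)"
  have "real p * \<bar>A (Suc i) (Suc j) (Suc k)\<bar>
      = cmod (\<Sum>l<p. cnj (dft_root p) ^ (k * l) * ?D l $$ (i, j))"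
    unfolding dft_slice_inversion[OF assms] by (simp add: norm_mult)
  also have "\<dots> \<le> (\<Sum>l<p. KM_Sigma m n p A 1 (Suc l))"
  proof (rule sum_norm_le)
    show "cmod (cnj (dft_root p) ^ (k * l) * ?D l $$ (i, j)) \<le> KM_Sigma m n p A 1 (Suc l)" for l
      using cmod_entry_le_largest_singular_value[of i "?D l" j] i j
      by (simp add: KM_Sigma_def norm_mult norm_power cmod_dft_root dft_slice_dims)
  qed
  also have "\<dots> = real p * KM_S m n p A 1 1 1"
    using k by (simp add: KM_S_first[unfolded One_nat_def] sum.atLeast1_atMost_eq)
  finally show ?thesis using k by simp
qed

theorem theorem5p1:
  fixes A :: tensor and m n p :: nat
  assumes "m \<ge> 1" and "n \<ge> 1" and "p \<ge> 1"
  shows "tensor_sigma1 m n p A = KM_S m n p A 1 1 1 \<and>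
    KM_S m n p A 1 1 1
      \<ge> Max {\<bar>A i j k\<bar> | i j k. i \<in> {1..m} \<and> j \<in> {1..n} \<and> k \<in> {1..p}}"
proof
  let ?T = "tensor_singular_values m n p A"
  have fin: "finite ?T"
    unfolding tensor_singular_values_def by (rule finite_image_set2) auto
  have one: "1 \<in> {1..min m n}" "1 \<in> {1..p}" using assms by auto
  \<comment> \<open>The largest singular value is \<open>\<bar>S(1,1,1)\<bar>\<close>, and \<open>S(1,1,1)\<close> is nonnegative since it bounds an
    absolute value.\<close>
  have "KM_S m n p A 1 1 1 = \<bar>KM_S m n p A 1 1 1\<bar>"
    using abs_KM_S_le[OF one(1) assms(3), of A 1] by linarith
  then have "KM_S m n p A 1 1 1 \<in> ?T" using one unfolding tensor_singular_values_def by blast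
  moreover have "y \<le> KM_S m n p A 1 1 1" if "y \<in> ?T" for y
    using that abs_KM_S_le[OF _ assms(3)] unfolding tensor_singular_values_def by blast
  ultimately show "tensor_sigma1 m n p A = KM_S m n p A 1 1 1"
    unfolding tensor_sigma1_def by (intro Max_eqI fin)
next
  let ?E = "{\<bar>A i j k\<bar> | i j k. i \<in> {1..m} \<and> j \<in> {1..n} \<and> k \<in> {1..p}}"
  have E: "?E = (\<lambda>(i, j, k). \<bar>A (Suc i) (Suc j) (Suc k)\<bar>) ` ({..<m} \<times> {..<n} \<times> {..<p})"
    (is "_ = ?R")
  proof (intro subset_antisym subsetI)
    fix x assume "x \<in> ?E"
    then obtain i j k where x: "x = \<bar>A i j k\<bar>" and "i \<in> {1..m}" "j \<in> {1..n}" "k \<in> {1..p}"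
      by blast
    then show "x \<in> ?R" by (intro image_eqI[of _ _ "(i - 1, j - 1, k - 1)"]) auto
  qed fastforce
  have "?E \<noteq> {}" using assms unfolding E by (simp add: lessThan_empty_iff)
  then show "Max ?E \<le> KM_S m n p A 1 1 1"
    unfolding E using abs_entry_le_KM_S by (subst Max_le_iff) auto
qed

end
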